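(* Let $S$ be a WPT surface (a polynomial translation surface which is a Weingarten surface) in $3$-dimensional Euclidean space $\mathbb{E}^3$. Then one of the following holds: (i) $S$ is a cylinder, in which case $K=0$; (ii) $S$ is a paraboloid of revolution, in which case the mean curvature $H$ and the Gaussian curvature $K$ are positive everywhere and related by the relation $$8aH^2=\sqrt{K}\,\bigl(2a+\sqrt{K}\bigr)^2,$$ where $a$ is a positive constant.
   Context: A translation surface in $\mathbb{E}^3$ is a surface which can be parametrized, locally, as $r(u,v)=(u,v,f(u)+g(v))$, where $f$ and $g$ are smooth functions. It is a polynomial translation surface (PT surface) if $f$ and $g$ are polynomials. Write $\alpha=f'$ and $\beta=g'$. The mean curvature $H$ and the Gaussian curvature $K$ are given by $$H=\frac{(1+\beta(v)^2)\alpha'(u)+(1+\alpha(u)^2)\beta'(v)}{2\,[1+\alpha(u)^2+\beta(v)^2]^{3/2}},\qquad K=\frac{\alpha'(u)\beta'(v)}{[1+\alpha(u)^2+\beta(v)^2]^2}.$$ A surface is called a Weingarten surface if there is some (smooth) relation $W(\kappa_1,\kappa_2)=0$ between its two principal curvatures $\kappa_1$ and $\kappa_2$, or equivalently a (smooth) relation $U(K,H)=0$ between its mean curvature $H$ and its Gaussian curvature $K$; this is understood as being characterized by the Jacobian condition $$\frac{\partial H}{\partial u}\frac{\partial K}{\partial v}-\frac{\partial H}{\partial v}\frac{\partial K}{\partial u}=0\quad\text{identically in }(u,v).$$ A WPT surface is a PT surface that is a Weingarten surface. "Cylinder" is meant in the generalized sense of a surface swept out by mutually parallel straight lines through the points of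 a curve (planes included); here it is a surface of the form $r(u,v)=(u,v,cu+g(v))$ or $r(u,v)=(u,v,f(u)+cv)$, up to translation, with $f$, $g$ arbitrary polynomials and $c\in\mathbb{R}$ (possibly zero). A paraboloid of revolution is a surface congruent to a graph $z=c(x^2+y^2)$ with $c$ a nonzero real constant.
   Formalization: "H positive everywhere" is read as: H is positive everywhere for a suitable choice of unit normal (one fixed sign for the whole surface); with the displayed formula, H is negative on downward-opening paraboloids such as z = -(x²+y²). *)

theory Defs
  imports "HOL-Analysis.Analysis" "HOL-Computational_Algebra.Polynomial"
begin

definition translation_patch :: "(real \<Rightarrow> real) \<Rightarrow> (real \<Rightarrow> real) \<Rightarrow> real \<times> real \<Rightarrow> real ^ 3"
  where "translation_patch f g = (\<lambda>(u, v). vector [u, v, f u + g v])"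

definition translation_surface :: "(real \<Rightarrow> real) \<Rightarrow> (real \<Rightarrow> real) \<Rightarrow> (real ^ 3) set"
  where "translation_surface f g = range (translation_patch f g)"

text \<open>The mean curvature is taken with respect to the upward unit normal; it changes sign
  with the orientation.\<close>

definition mean_curvature :: "(real \<Rightarrow> real) \<Rightarrow> (real \<Rightarrow> real) \<Rightarrow> real \<Rightarrow> real \<Rightarrow> real"
  where "mean_curvature f g u v =
    ((1 + (deriv g v)\<^sup>2) * deriv (deriv f) u + (1 + (deriv f u)\<^sup>2) * deriv (deriv g) v)
      / (2 * (1 + (deriv f u)\<^sup>2 + (deriv g v)\<^sup>2) powr (3 / 2))"

definition gauss_curvature :: "(real \<Rightarrow> real) \<Rightarrow> (real \<Rightarrow> real) \<Rightarrow> real \<Rightarrow> real \<Rightarrow> real"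
  where "gauss_curvature f g u v =
    deriv (deriv f) u * deriv (deriv g) v / (1 + (deriv f u)\<^sup>2 + (deriv g v)\<^sup>2)\<^sup>2"

definition weingarten :: "(real \<Rightarrow> real) \<Rightarrow> (real \<Rightarrow> real) \<Rightarrow> bool"
  where "weingarten f g \<longleftrightarrow> (\<forall>u v.
      deriv (\<lambda>s. mean_curvature f g s v) u * deriv (\<lambda>t. gauss_curvature f g u t) v
    - deriv (\<lambda>t. mean_curvature f g u t) v * deriv (\<lambda>s. gauss_curvature f g s v) u = 0)"

text \<open>Generalized cylinders (planes included) among polynomial translation surfaces: the rulings
  are parallel to \<open>(1, 0, c)\<close> in the first case and to \<open>(0, 1, c)\<close> in the second.\<close>

definition is_cylinder :: "(real ^ 3) set \<Rightarrow> bool"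
  where "is_cylinder S \<longleftrightarrow> (\<exists>(t :: real ^ 3) (c :: real) (p :: real poly).
      S = (+) t ` translation_surface (\<lambda>u. c * u) (poly p) \<or>
      S = (+) t ` translation_surface (poly p) (\<lambda>v. c * v))"

definition congruent_sets :: "(real ^ 3) set \<Rightarrow> (real ^ 3) set \<Rightarrow> bool"
  where "congruent_sets A B \<longleftrightarrow> (\<exists>T. (\<forall>x y. dist (T x) (T y) = dist x y) \<and> T ` A = B)"

definition is_paraboloid_of_revolution :: "(real ^ 3) set \<Rightarrow> bool"
  where "is_paraboloid_of_revolution S \<longleftrightarrow>
    (\<exists>c. c \<noteq> 0 \<and> congruent_sets S {p. p $ 3 = c * ((p $ 1)\<^sup>2 + (p $ 2)\<^sup>2)})"

end

theory Submission imports Defs begin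

text \<open>
  Write \<open>A = f'(u)\<close>, \<open>p = f''(u)\<close>, \<open>r = f'''(u)\<close> and \<open>B = g'(v)\<close>, \<open>q = g''(v)\<close>, \<open>s = g'''(v)\<close>, and
  \<open>W = 1 + A\<^sup>2 + B\<^sup>2\<close>.  After clearing denominators, the Jacobian of \<open>(H, K)\<close> is a polynomial in
  these quantities.  Modulo \<open>W\<close>, only the derivatives of the powers of \<open>W\<close> in the denominators of
  \<open>H\<close> and \<open>K\<close> count, and both products in the Jacobian then contain the same factor
  \<open>W\<^sub>u W\<^sub>v\<close> and cancel.  So the polynomial is divisible by \<open>W\<close>, and dividing by \<open>W > 0\<close> leaves
  the equation of \<open>weingarten_reduced\<close>.

  Fix \<open>u\<close> with \<open>p r \<noteq> 0\<close>, and let \<open>B\<close>, as a polynomial in \<open>v\<close>, have degree \<open>n \<ge> 1\<close> and leading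
  coefficient \<open>b\<close>.  The dominant part of the reduced equation is \<open>p r B\<^sup>3 (B s - 3 q\<^sup>2)\<close>, whose
  coefficient at degree \<open>5 n - 2\<close> is \<open>- p r n (2 n + 1) b\<^sup>5\<close>, while all other terms have
  smaller degree (\<open>dominant_part_nonzero\<close>); so the equation cannot hold for all \<open>v\<close>.  Hence
  \<open>f''\<close> is constant as soon as \<open>g''\<close> is not the zero polynomial.  The Weingarten condition is
  symmetric in \<open>f\<close> and \<open>g\<close>, so either one of them has degree at most one, and the surface is a
  cylinder, or both are quadratic.  In the second case the reduced equation collapses to
  \<open>8 A B p\<^sup>2 q\<^sup>2 (p - q) = 0\<close>, which forces \<open>p = q = c\<close> for a constant \<open>c \<noteq> 0\<close>; completing the
  square shows a translate of the paraboloid \<open>z = (c/2) (x\<^sup>2 + y\<^sup>2)\<close>.  There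
  \<open>H = c (W + 1) / (2 W\<^bsup>3/2\<^esup>)\<close> and \<open>\<surd>K = \<bar>c\<bar> / W\<close>, and eliminating \<open>W\<close> gives the relation with
  \<open>a = \<bar>c\<bar> / 2\<close>.
\<close>

section \<open>Curvatures of polynomial translation surfaces\<close>

lemma deriv_poly: "deriv (poly f) = poly (pderiv f)" for f :: "real poly"
  by (rule ext) (rule DERIV_imp_deriv, rule poly_DERIV)

lemma mean_curvature_swap: "mean_curvature f g u v = mean_curvature g f v u"
  unfolding mean_curvature_def by (simp add: algebra_simps)

lemma gauss_curvature_swap: "gauss_curvature f g u v = gauss_curvature g f v u"
  unfolding gauss_curvature_def by (simp add: algebra_simps)

lemma weingarten_swap:
  assumes "weingarten f g"
  shows "weingarten g f"
  unfolding weingarten_def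
proof (intro allI)
  fix u v
  from assms have
    "deriv (\<lambda>s. mean_curvature f g s u) v * deriv (\<lambda>t. gauss_curvature f g v t) u
      - deriv (\<lambda>t. mean_curvature f g v t) u * deriv (\<lambda>s. gauss_curvature f g s u) v = 0"
    unfolding weingarten_def by blast
  then show "deriv (\<lambda>s. mean_curvature g f s v) u * deriv (\<lambda>t. gauss_curvature g f u t) v
      - deriv (\<lambda>t. mean_curvature g f u t) v * deriv (\<lambda>s. gauss_curvature g f s v) u = 0"
    by (simp add: mean_curvature_swap[of f g] gauss_curvature_swap[of f g] mult.commute)
qed

lemma deriv_mean_curvature_fst:
  fixes f g :: "real poly" and u v :: real
  defines "A \<equiv> poly (pderiv f) u" and "p \<equiv> poly (pderiv (pderiv f)) u"
    and "r \<equiv> poly (pderiv (pderiv (pderiv f))) u"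
    and "B \<equiv> poly (pderiv g) v" and "q \<equiv> poly (pderiv (pderiv g)) v"
  defines "W \<equiv> 1 + A\<^sup>2 + B\<^sup>2"
  shows "deriv (\<lambda>t. mean_curvature (poly f) (poly g) t v) u =
    (((1 + B\<^sup>2) * r + 2 * A * p * q) * W - 3 * A * p * ((1 + B\<^sup>2) * p + (1 + A\<^sup>2) * q))
      / (2 * W powr (5 / 2))"
proof (rule DERIV_imp_deriv)
  have Wpos: "W > 0"
    unfolding W_def by (simp add: add_pos_nonneg)
  have powr: "W powr (3 / 2) = W * W powr (1 / 2)" "W powr (5 / 2) = W\<^sup>2 * W powr (1 / 2)"
    using Wpos powr_add[of W 1 "1/2"] powr_add[of W 2 "1/2"] by simp_all
  define Z where "Z = W powr (1 / 2)"
  have Z: "Z > 0" "Z * Z = W"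
    using Wpos by (simp_all add: Z_def flip: powr_add)
  define N where "N = (\<lambda>t. (1 + B\<^sup>2) * poly (pderiv (pderiv f)) t + (1 + (poly (pderiv f) t)\<^sup>2) * q)"
  define V where "V = (\<lambda>t. 1 + (poly (pderiv f) t)\<^sup>2 + B\<^sup>2)"
  have Vu: "V u = W"
    by (simp add: V_def W_def A_def)
  have dN: "(N has_real_derivative (1 + B\<^sup>2) * r + 2 * A * p * q) (at u)"
    unfolding N_def r_def A_def p_def
    by (auto intro!: derivative_eq_intros simp: poly_DERIV)
  have dV: "(V has_real_derivative 2 * A * p) (at u)"
    unfolding V_def A_def p_def
    by (auto intro!: derivative_eq_intros simp: poly_DERIV)
  have dP: "((\<lambda>t. 2 * V t powr (3 / 2)) has_real_derivative 2 * ((3 / 2) * Z * (2 * A * p))) (at u)"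
    using dV Wpos
    by (auto intro!: derivative_eq_intros simp: Vu Z_def)
  have "((\<lambda>t. N t / (2 * V t powr (3 / 2))) has_real_derivative
      (((1 + B\<^sup>2) * r + 2 * A * p * q) * (2 * V u powr (3 / 2))
        - N u * (2 * ((3 / 2) * Z * (2 * A * p))))
        / ((2 * V u powr (3 / 2)) * (2 * V u powr (3 / 2)))) (at u)"
    by (rule DERIV_divide[OF dN dP]) (use Wpos Vu in simp)
  moreover have "(\<lambda>t. mean_curvature (poly f) (poly g) t v) = (\<lambda>t. N t / (2 * V t powr (3 / 2)))"
    unfolding mean_curvature_def N_def V_def deriv_poly q_def B_def ..
  moreover have "(((1 + B\<^sup>2) * r + 2 * A * p * q) * (2 * V u powr (3 / 2))
        - N u * (2 * ((3 / 2) * Z * (2 * A * p))))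
        / ((2 * V u powr (3 / 2)) * (2 * V u powr (3 / 2)))
    = (((1 + B\<^sup>2) * r + 2 * A * p * q) * W - 3 * A * p * ((1 + B\<^sup>2) * p + (1 + A\<^sup>2) * q))
      / (2 * W powr (5 / 2))"
  proof -
    have Nu: "N u = (1 + B\<^sup>2) * p + (1 + A\<^sup>2) * q"
      by (simp add: N_def p_def A_def)
    have "(X * (2 * (W * Z)) - Y * (2 * ((3 / 2) * Z * (2 * A * p)))) / ((2 * (W * Z)) * (2 * (W * Z)))
       = (X * W - 3 * A * p * Y) / (2 * (W\<^sup>2 * Z))" for X Y
      using Wpos Z(1) by (simp add: divide_simps power2_eq_square) (simp add: algebra_simps)
    then show ?thesis
      unfolding Vu Nu powr Z_def[symmetric] .
  qed
  ultimately show "((\<lambda>t. mean_curvature (poly f) (poly g) t v) has_real_derivative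
    (((1 + B\<^sup>2) * r + 2 * A * p * q) * W - 3 * A * p * ((1 + B\<^sup>2) * p + (1 + A\<^sup>2) * q))
      / (2 * W powr (5 / 2))) (at u)"
    by simp
qed

lemma deriv_gauss_curvature_fst:
  fixes f g :: "real poly" and u v :: real
  defines "A \<equiv> poly (pderiv f) u" and "p \<equiv> poly (pderiv (pderiv f)) u"
    and "r \<equiv> poly (pderiv (pderiv (pderiv f))) u"
    and "B \<equiv> poly (pderiv g) v" and "q \<equiv> poly (pderiv (pderiv g)) v"
  defines "W \<equiv> 1 + A\<^sup>2 + B\<^sup>2"
  shows "deriv (\<lambda>t. gauss_curvature (poly f) (poly g) t v) u = q * (r * W - 4 * A * p\<^sup>2) / W ^ 3"
proof (rule DERIV_imp_deriv)
  have Wpos: "W > 0"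
    unfolding W_def by (simp add: add_pos_nonneg)
  define V where "V = (\<lambda>t. 1 + (poly (pderiv f) t)\<^sup>2 + B\<^sup>2)"
  have Vu: "V u = W"
    by (simp add: V_def W_def A_def)
  have dV: "((\<lambda>t. (V t)\<^sup>2) has_real_derivative 2 * W * (2 * A * p)) (at u)"
    unfolding V_def A_def p_def W_def
    by (auto intro!: derivative_eq_intros simp: poly_DERIV)
  have dM: "((\<lambda>t. poly (pderiv (pderiv f)) t * q) has_real_derivative r * q) (at u)"
    unfolding r_def by (auto intro!: derivative_eq_intros simp: poly_DERIV)
  have "((\<lambda>t. poly (pderiv (pderiv f)) t * q / (V t)\<^sup>2) has_real_derivative
      (r * q * (V u)\<^sup>2 - poly (pderiv (pderiv f)) u * q * (2 * W * (2 * A * p)))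
        / ((V u)\<^sup>2 * (V u)\<^sup>2)) (at u)"
    by (rule DERIV_divide[OF dM dV]) (use Wpos Vu in simp)
  moreover have "(r * q * (V u)\<^sup>2 - poly (pderiv (pderiv f)) u * q * (2 * W * (2 * A * p)))
        / ((V u)\<^sup>2 * (V u)\<^sup>2) = q * (r * W - 4 * A * p\<^sup>2) / W ^ 3"
    using Wpos unfolding Vu p_def[symmetric]
    by (simp add: divide_simps power2_eq_square power3_eq_cube) (simp add: algebra_simps)
  moreover have "(\<lambda>t. gauss_curvature (poly f) (poly g) t v)
      = (\<lambda>t. poly (pderiv (pderiv f)) t * q / (V t)\<^sup>2)"
    unfolding gauss_curvature_def V_def deriv_poly q_def B_def ..
  ultimately show "((\<lambda>t. gauss_curvature (poly f) (poly g) t v) has_real_derivative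
      q * (r * W - 4 * A * p\<^sup>2) / W ^ 3) (at u)"
    by simp
qed

section \<open>The reduced Weingarten equation\<close>

text \<open>
  The Jacobian with denominators cleared, divided by \<open>W\<close> and sorted by monomials in the
  quantities \<open>B\<close>, \<open>q\<close>, \<open>s\<close> that depend on \<open>v\<close>.  This form is chosen so that, for fixed \<open>u\<close>, the
  two terms of highest degree in \<open>v\<close> (namely \<open>B\<^sup>4 s\<close> and \<open>B\<^sup>3 q\<^sup>2\<close>) stand apart from the others.
\<close>

lemma weingarten_reduced:
  fixes f g :: "real poly" and u v :: real
  defines "A \<equiv> poly (pderiv f) u" and "p \<equiv> poly (pderiv (pderiv f)) u"
    and "r \<equiv> poly (pderiv (pderiv (pderiv f))) u"
    and "B \<equiv> poly (pderiv g) v" and "q \<equiv> poly (pderiv (pderiv g)) v"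
    and "s \<equiv> poly (pderiv (pderiv (pderiv g))) v"
  assumes "weingarten (poly f) (poly g)"
  shows "p * r * (B ^ 3 * (B * s - 3 * q\<^sup>2))
    + (p * r * (2 + A\<^sup>2) - 3 * A * p ^ 3) * (s * B\<^sup>2)
    + (p * r * (1 + A\<^sup>2) - 3 * A * p ^ 3) * s
    + (2 * A * p\<^sup>2 - (1 + A\<^sup>2) * r) * (q * s * B\<^sup>2)
    + (3 * A * p\<^sup>2 * (1 + A\<^sup>2) - (1 + A\<^sup>2)\<^sup>2 * r) * (q * s)
    + (8 * A * p ^ 3 - (3 + 2 * A\<^sup>2) * p * r) * (B * q\<^sup>2)
    + (3 * (1 + A\<^sup>2) * r - 8 * A * p\<^sup>2) * (B * q ^ 3) = 0"
    (is "?E = 0")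
proof -
  define W where "W = 1 + A\<^sup>2 + B\<^sup>2"
  have Wpos: "W > 0"
    unfolding W_def by (simp add: add_pos_nonneg)
  define N where "N = (1 + B\<^sup>2) * p + (1 + A\<^sup>2) * q"
  define h where "h = ((1 + B\<^sup>2) * r + 2 * A * p * q) * W - 3 * A * p * N"
  define h' where "h' = ((1 + A\<^sup>2) * s + 2 * B * q * p) * W - 3 * B * q * N"
  define k where "k = q * (r * W - 4 * A * p\<^sup>2)"
  define k' where "k' = p * (s * W - 4 * B * q\<^sup>2)"
  have comm: "1 + B\<^sup>2 + A\<^sup>2 = W" "(1 + A\<^sup>2) * q + (1 + B\<^sup>2) * p = N"
    by (simp_all add: W_def N_def)
  have Hu: "deriv (\<lambda>t. mean_curvature (poly f) (poly g) t v) u = h / (2 * W powr (5 / 2))"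
    using deriv_mean_curvature_fst[of f g v u]
    unfolding h_def W_def N_def A_def p_def r_def B_def q_def by simp
  have Hv: "deriv (\<lambda>t. mean_curvature (poly f) (poly g) u t) v = h' / (2 * W powr (5 / 2))"
    using deriv_mean_curvature_fst[of g f u v]
    unfolding mean_curvature_swap[of "poly g"] h'_def
      A_def[symmetric] p_def[symmetric] B_def[symmetric] q_def[symmetric] s_def[symmetric] comm .
  have Ku: "deriv (\<lambda>t. gauss_curvature (poly f) (poly g) t v) u = k / W ^ 3"
    using deriv_gauss_curvature_fst[of f g v u]
    unfolding k_def W_def A_def p_def r_def B_def q_def by simp
  have Kv: "deriv (\<lambda>t. gauss_curvature (poly f) (poly g) u t) v = k' / W ^ 3"
    using deriv_gauss_curvature_fst[of g f u v]
    unfolding gauss_curvature_swap[of "poly g"] k'_def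
      A_def[symmetric] p_def[symmetric] B_def[symmetric] q_def[symmetric] s_def[symmetric] comm .
  have "h / (2 * W powr (5 / 2)) * (k' / W ^ 3) - h' / (2 * W powr (5 / 2)) * (k / W ^ 3) = 0"
    using assms(7) unfolding weingarten_def Hu[symmetric] Hv[symmetric] Ku[symmetric] Kv[symmetric]
    by blast
  then have "(h * k' - h' * k) / (2 * W powr (5 / 2) * W ^ 3) = 0"
    by (simp add: diff_divide_distrib)
  then have "h * k' - h' * k = 0"
    using Wpos by simp
  moreover have "h * k' - h' * k = W * ?E"
    unfolding h_def h'_def k_def k'_def N_def W_def by algebra
  ultimately show ?thesis
    using Wpos by simp
qed

text \<open>
  The comparison of leading terms.  With \<open>n = degree B\<close> and leading coefficient \<open>b\<close>, the
  products \<open>B s\<close> and \<open>q\<^sup>2\<close> contribute \<open>n (n - 1) b\<^sup>2\<close> and \<open>n\<^sup>2 b\<^sup>2\<close> at degree \<open>2 n - 2\<close>; they cannot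
  cancel in \<open>B s - 3 q\<^sup>2\<close> because \<open>n (n - 1) < 3 n\<^sup>2\<close>.  Every remaining monomial has at most four
  factors and carries at least two derivatives, against five factors and two derivatives in
  the dominant part.
\<close>

lemma dominant_part_nonzero:
  fixes B :: "real poly" and c c1 c2 c3 c4 c5 c6 :: real
  defines "q \<equiv> pderiv B" and "s \<equiv> pderiv (pderiv B)"
  assumes "c \<noteq> 0" and "degree B > 0"
  shows "smult c (B ^ 3 * (B * s - smult 3 (q ^ 2)))
    + (smult c1 (s * B ^ 2) + smult c2 s + smult c3 (q * s * B ^ 2) + smult c4 (q * s)
      + smult c5 (B * q ^ 2) + smult c6 (B * q ^ 3)) \<noteq> 0"
    (is "?M + ?R \<noteq> 0")
proof -
  define n where "n = degree B"
  define b where "b = lead_coeff B"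
  have n: "n > 0" and b: "b \<noteq> 0"
    using assms(4) by (auto simp: n_def b_def)
  have dq: "degree q = n - 1"
    by (simp add: q_def n_def degree_pderiv)
  have ds: "degree s = n - 2"
    by (simp add: s_def n_def degree_pderiv)
  have cq: "coeff q (n - 1) = real n * b"
    using n by (simp add: q_def b_def coeff_pderiv n_def)
  have "coeff (B * s) (2 * n - 2) = real n * (real n - 1) * b\<^sup>2 \<and> degree (B * s) \<le> 2 * n - 2"
  proof (cases "n = 1")
    case True
    then have "s = 0"
      using dq pderiv_eq_0_iff[of q] by (simp add: s_def q_def)
    then show ?thesis
      using True by simp
  next
    case False
    then have n2: "n \<ge> 2"
      using n by simp
    have "coeff s (n - 2) = real (n - 1) * coeff q (n - 1)"
      using n2 by (simp add: s_def coeff_pderiv flip: q_def Suc_diff_le)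
    then have "coeff (B * s) (n + (n - 2)) = real n * (real n - 1) * b\<^sup>2"
      using coeff_mult_degree_sum[of B s] n2 cq
      by (simp add: ds n_def b_def of_nat_diff power2_eq_square)
    moreover have "n + (n - 2) = 2 * n - 2"
      using n2 by simp
    ultimately show ?thesis
      using degree_mult_le[of B s] by (simp add: ds flip: n_def)
  qed
  moreover have "coeff (q ^ 2) (2 * n - 2) = (real n * b)\<^sup>2"
  proof -
    have "coeff (q ^ 2) ((n - 1) + (n - 1)) = (real n * b)\<^sup>2"
      using coeff_mult_degree_sum[of q q] unfolding dq cq power2_eq_square .
    moreover have "(n - 1) + (n - 1) = 2 * n - 2"
      by simp
    ultimately show ?thesis
      by simp
  qed
  moreover have "degree (q ^ 2) \<le> 2 * n - 2"
    using degree_power_le[of q 2] by (simp add: dq)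
  ultimately have D: "coeff (B * s - smult 3 (q ^ 2)) (2 * n - 2) = - (real n * (2 * real n + 1) * b\<^sup>2)"
    and Dle: "degree (B * s - smult 3 (q ^ 2)) \<le> 2 * n - 2"
    by (auto simp: power2_eq_square algebra_simps intro: degree_diff_le)
  have Dnz: "real n * (2 * real n + 1) * b\<^sup>2 \<noteq> 0"
    using n b by (simp add: add_nonneg_eq_0_iff)
  have Ddeg: "degree (B * s - smult 3 (q ^ 2)) = 2 * n - 2"
  proof (rule antisym[OF Dle le_degree])
    show "coeff (B * s - smult 3 (q ^ 2)) (2 * n - 2) \<noteq> 0"
      unfolding D using Dnz by (simp only: neg_equal_0_iff_equal not_False_eq_True)
  qed
  have "B \<noteq> 0"
    using b by (auto simp: b_def)
  then have "degree (B ^ 3) = 3 * n"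
    by (simp add: degree_power_eq n_def)
  then have B3: "degree (B ^ 3) = 3 * n" "coeff (B ^ 3) (3 * n) = b ^ 3"
    using lead_coeff_power[of B 3] by (simp_all add: b_def)
  have "coeff ?M (3 * n + (2 * n - 2)) = - (c * b ^ 3 * (real n * (2 * real n + 1) * b\<^sup>2))"
    using coeff_mult_degree_sum[of "B ^ 3" "B * s - smult 3 (q ^ 2)"]
    unfolding B3 Ddeg D coeff_smult by simp
  then have "coeff ?M (3 * n + (2 * n - 2)) \<noteq> 0"
    using assms(3) b Dnz by simp
  moreover have "degree ?R < 3 * n + (2 * n - 2)"
  proof -
    have pow: "degree (B ^ 2) \<le> 2 * n" "degree (q ^ 2) \<le> 2 * (n - 1)" "degree (q ^ 3) \<le> 3 * (n - 1)"
      using degree_power_le[of B 2] degree_power_le[of q 2] degree_power_le[of q 3]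
      by (simp_all add: dq mult.commute flip: n_def)
    have "degree (s * B ^ 2) < 3 * n + (2 * n - 2)" "degree s < 3 * n + (2 * n - 2)"
      "degree (q * s) < 3 * n + (2 * n - 2)"
      using degree_mult_le[of s "B ^ 2"] degree_mult_le[of q s] pow n by (auto simp: ds dq)
    moreover have "degree (q * s * B ^ 2) < 3 * n + (2 * n - 2)"
      using degree_mult_le[of q s] degree_mult_le[of "q * s" "B ^ 2"] pow n
      unfolding ds dq by linarith
    moreover have "degree (B * q ^ 2) < 3 * n + (2 * n - 2)" "degree (B * q ^ 3) < 3 * n + (2 * n - 2)"
      using degree_mult_le[of B "q ^ 2"] degree_mult_le[of B "q ^ 3"] pow n
      unfolding n_def[symmetric] by linarith+
    ultimately show ?thesis
      by (intro degree_add_less le_less_trans[OF degree_smult_le])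
  qed
  then have "coeff ?R (3 * n + (2 * n - 2)) = 0"
    by (rule coeff_eq_0)
  ultimately have "coeff (?M + ?R) (3 * n + (2 * n - 2)) \<noteq> 0"
    by (subst coeff_add) simp
  then show ?thesis
    by (metis coeff_0)
qed

lemma weingarten_fst_quadratic:
  fixes f g :: "real poly"
  assumes W: "weingarten (poly f) (poly g)" and g: "pderiv (pderiv g) \<noteq> 0"
  shows "pderiv (pderiv (pderiv f)) = 0"
proof (rule ccontr)
  assume r: "pderiv (pderiv (pderiv f)) \<noteq> 0"
  then have "pderiv (pderiv f) \<noteq> 0"
    by auto
  with r have "pderiv (pderiv f) * pderiv (pderiv (pderiv f)) \<noteq> 0"
    by simp
  then obtain u where u: "poly (pderiv (pderiv f) * pderiv (pderiv (pderiv f))) u \<noteq> 0"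
    using poly_all_0_iff_0 by blast
  define A p r where "A = poly (pderiv f) u" and "p = poly (pderiv (pderiv f)) u"
    and "r = poly (pderiv (pderiv (pderiv f))) u"
  define B where "B = pderiv g"
  have "p * r \<noteq> 0"
    using u by (simp add: p_def r_def)
  moreover have "degree B > 0"
    using g by (auto simp: B_def pderiv_eq_0_iff)
  ultimately have "smult (p * r) (B ^ 3 * (B * pderiv (pderiv B) - smult 3 ((pderiv B) ^ 2)))
    + (smult (p * r * (2 + A\<^sup>2) - 3 * A * p ^ 3) (pderiv (pderiv B) * B ^ 2)
      + smult (p * r * (1 + A\<^sup>2) - 3 * A * p ^ 3) (pderiv (pderiv B))
      + smult (2 * A * p\<^sup>2 - (1 + A\<^sup>2) * r) (pderiv B * pderiv (pderiv B) * B ^ 2)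
      + smult (3 * A * p\<^sup>2 * (1 + A\<^sup>2) - (1 + A\<^sup>2)\<^sup>2 * r) (pderiv B * pderiv (pderiv B))
      + smult (8 * A * p ^ 3 - (3 + 2 * A\<^sup>2) * p * r) (B * pderiv B ^ 2)
      + smult (3 * (1 + A\<^sup>2) * r - 8 * A * p\<^sup>2) (B * pderiv B ^ 3)) \<noteq> 0"
    (is "?P \<noteq> 0")
    by (rule dominant_part_nonzero)
  moreover have "poly ?P v = 0" for v
    using weingarten_reduced[OF W, of u v]
    unfolding A_def[symmetric] p_def[symmetric] r_def[symmetric] B_def[symmetric]
    by (simp only: poly_add poly_smult poly_mult poly_power poly_diff add.assoc)
  ultimately show False
    using poly_all_0_iff_0 by blast
qed

lemma weingarten_equal_second_derivatives:
  fixes f g :: "real poly"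
  assumes W: "weingarten (poly f) (poly g)"
    and "pderiv (pderiv f) \<noteq> 0" "pderiv (pderiv g) \<noteq> 0"
  obtains c where "c \<noteq> 0" "pderiv (pderiv f) = [:c:]" "pderiv (pderiv g) = [:c:]"
proof -
  have third: "pderiv (pderiv (pderiv f)) = 0" "pderiv (pderiv (pderiv g)) = 0"
    using weingarten_fst_quadratic[OF W] weingarten_fst_quadratic[OF weingarten_swap[OF W]] assms
    by auto
  then obtain c d where cd: "pderiv (pderiv f) = [:c:]" "pderiv (pderiv g) = [:d:]"
    by (metis pderiv_eq_0_iff degree_eq_zeroE)
  then have nz: "c \<noteq> 0" "d \<noteq> 0"
    using assms by auto
  have "pderiv f \<noteq> 0" "pderiv g \<noteq> 0"
    using assms by auto
  then obtain u v where uv: "poly (pderiv f) u \<noteq> 0" "poly (pderiv g) v \<noteq> 0"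
    by (meson poly_all_0_iff_0)
  have "8 * poly (pderiv f) u * c\<^sup>2 * d\<^sup>2 * poly (pderiv g) v * (c - d) = 0"
    using weingarten_reduced[OF W, of u v] unfolding third cd
    by (simp add: power2_eq_square power3_eq_cube algebra_simps)
  then have "c = d"
    using uv nz by simp
  with cd nz show thesis
    using that by blast
qed

section \<open>The two families of surfaces\<close>

lemma poly_of_pderiv_pderiv_const:
  fixes f :: "real poly"
  assumes "pderiv (pderiv f) = [:c:]"
  obtains d e where "f = [:e, d, c / 2:]"
proof
  have *: "(real m + 1) * (real m + 2) * coeff f (Suc (Suc m)) = coeff [:c:] m" for m
    using arg_cong[OF assms, of "\<lambda>h. coeff h m"] by (simp add: coeff_pderiv algebra_simps)
  show "f = [:coeff f 0, coeff f 1, c / 2:]"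
  proof (rule poly_eqI)
    fix n
    consider "n = 0" | "n = 1" | "n = Suc (Suc 0)" | m where "n = Suc (Suc (Suc m))"
      by (metis One_nat_def not0_implies_Suc)
    then show "coeff f n = coeff [:coeff f 0, coeff f 1, c / 2:] n"
    proof cases
      case 3
      then show ?thesis
        using *[of 0] by simp
    next
      case (4 m)
      then show ?thesis
        using *[of "Suc m"] by (simp add: add_nonneg_eq_0_iff)
    qed simp_all
  qed
qed

lemma translate_translation_surface:
  "(+) (vector [0, 0, d]) ` translation_surface f g = translation_surface (\<lambda>u. d + f u) g"
  "(+) (vector [0, 0, d]) ` translation_surface f g = translation_surface f (\<lambda>v. d + g v)"
  unfolding translation_surface_def translation_patch_def image_image
  by (auto intro!: image_cong simp: vec_eq_iff forall_3 algebra_simps)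

lemma is_cylinder_if_linear:
  fixes f g :: "real poly"
  assumes "pderiv (pderiv f) = 0 \<or> pderiv (pderiv g) = 0"
  shows "is_cylinder (translation_surface (poly f) (poly g))"
  using assms
proof
  assume "pderiv (pderiv f) = 0"
  then obtain d e where "f = [:e, d, 0 / 2:]"
    by (metis poly_of_pderiv_pderiv_const pCons_0_0)
  then have "poly f = (\<lambda>u. e + d * u)"
    by (auto simp: algebra_simps)
  then show ?thesis
    unfolding is_cylinder_def by (metis translate_translation_surface(1))
next
  assume "pderiv (pderiv g) = 0"
  then obtain d e where "g = [:e, d, 0 / 2:]"
    by (metis poly_of_pderiv_pderiv_const pCons_0_0)
  then have "poly g = (\<lambda>u. e + d * u)"
    by (auto simp: algebra_simps)
  then show ?thesis
    unfolding is_cylinder_def by (metis translate_translation_surface(2))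
qed

lemma is_paraboloid_of_revolution_if_equal_second_derivatives:
  fixes f g :: "real poly"
  assumes c: "c \<noteq> 0" and "pderiv (pderiv f) = [:c:]" "pderiv (pderiv g) = [:c:]"
  shows "is_paraboloid_of_revolution (translation_surface (poly f) (poly g))"
proof -
  obtain d e where f: "f = [:e, d, c / 2:]"
    using assms(2) by (rule poly_of_pderiv_pderiv_const)
  obtain d' e' where g: "g = [:e', d', c / 2:]"
    using assms(3) by (rule poly_of_pderiv_pderiv_const)
  define k where "k = c / 2"
  have k: "k \<noteq> 0" "c / 2 = k"
    using c by (simp_all add: k_def)
  \<comment> \<open>Completing both squares: the vertex lies over \<open>(- d / (2 k), - d' / (2 k))\<close>.\<close>
  define w :: "real ^ 3" where
    "w = vector [d / (2 * k), d' / (2 * k), d\<^sup>2 / (4 * k) + d'\<^sup>2 / (4 * k) - e - e']"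
  have square: "d\<^sup>2 / (4 * k) - e + (e + x * (d + x * k)) = k * (d / (2 * k) + x)\<^sup>2" for d e x
    using k(1) by (simp add: field_simps power2_eq_square)
  have vertex: "d\<^sup>2 / (4 * k) + d'\<^sup>2 / (4 * k) - e - e' + (poly f x + poly g y)
      = k * ((d / (2 * k) + x)\<^sup>2 + (d' / (2 * k) + y)\<^sup>2)" for x y
    using square[of d e x] square[of d' e' y] unfolding f g k(2) by (simp add: distrib_left)
  have "(+) w ` translation_surface (poly f) (poly g) = {p. p $ 3 = k * ((p $ 1)\<^sup>2 + (p $ 2)\<^sup>2)}"
  proof (rule set_eqI, rule iffI)
    fix x
    assume "x \<in> (+) w ` translation_surface (poly f) (poly g)"
    then show "x \<in> {p. p $ 3 = k * ((p $ 1)\<^sup>2 + (p $ 2)\<^sup>2)}"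
      by (auto simp: translation_surface_def translation_patch_def w_def vertex)
  next
    fix x :: "real ^ 3"
    assume x: "x \<in> {p. p $ 3 = k * ((p $ 1)\<^sup>2 + (p $ 2)\<^sup>2)}"
    have "x = w + translation_patch (poly f) (poly g) (x $ 1 - w $ 1, x $ 2 - w $ 2)"
      using x by (auto simp: vec_eq_iff forall_3 translation_patch_def w_def vertex)
    then show "x \<in> (+) w ` translation_surface (poly f) (poly g)"
      unfolding translation_surface_def by blast
  qed
  moreover have "dist (w + x) (w + y) = dist x y" for x y :: "real ^ 3"
    by simp
  ultimately show ?thesis
    unfolding is_paraboloid_of_revolution_def congruent_sets_def using k(1) by blast
qed

text \<open>
  Both curvatures are functions of \<open>W\<close> alone, \<open>H = c (W + 1) / (2 W\<^bsup>3/2\<^esup>)\<close> and \<open>K = (c / W)\<^sup>2\<close>.  The sign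
  of \<open>H\<close> is that of \<open>c\<close>, since the upward normal is the inner one for \<open>c > 0\<close> and the
  outer one for \<open>c < 0\<close>.
\<close>

lemma paraboloid_curvatures:
  fixes f g :: "real poly"
  assumes c: "c \<noteq> 0" and f: "pderiv (pderiv f) = [:c:]" and g: "pderiv (pderiv g) = [:c:]"
  defines "H \<equiv> mean_curvature (poly f) (poly g)" and "K \<equiv> gauss_curvature (poly f) (poly g)"
  shows "sgn c * H u v > 0" and "K u v > 0"
    and "8 * (\<bar>c\<bar> / 2) * (H u v)\<^sup>2 = sqrt (K u v) * (2 * (\<bar>c\<bar> / 2) + sqrt (K u v))\<^sup>2"
proof -
  define W where "W = 1 + (poly (pderiv f) u)\<^sup>2 + (poly (pderiv g) v)\<^sup>2"
  have Wpos: "W > 0"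
    unfolding W_def by (simp add: add_pos_nonneg)
  have H: "H u v = c * (W + 1) / (2 * W powr (3 / 2))"
    unfolding H_def mean_curvature_def deriv_poly f g W_def by (simp add: algebra_simps)
  have K: "K u v = (c / W)\<^sup>2"
    unfolding K_def gauss_curvature_def deriv_poly f g W_def[symmetric]
    by (simp add: power2_eq_square)
  have "sgn c * H u v = \<bar>c\<bar> * (W + 1) / (2 * W powr (3 / 2))"
    unfolding H by (simp add: abs_sgn mult_ac)
  also have "\<dots> > 0"
    using Wpos c by simp
  finally show "sgn c * H u v > 0" .
  show "K u v > 0"
    unfolding K using c Wpos by simp
  have sqrtK: "sqrt (K u v) = \<bar>c\<bar> / W"
    unfolding K using Wpos by simp
  have "(W powr (3 / 2))\<^sup>2 = W ^ 3"
    using Wpos by (simp add: power2_eq_square flip: powr_add)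
  then have H2: "(H u v)\<^sup>2 = c\<^sup>2 * (W + 1)\<^sup>2 / (4 * W ^ 3)"
    unfolding H by (simp add: power_divide power_mult_distrib)
  show "8 * (\<bar>c\<bar> / 2) * (H u v)\<^sup>2 = sqrt (K u v) * (2 * (\<bar>c\<bar> / 2) + sqrt (K u v))\<^sup>2"
  proof -
    have "8 * (x / 2) * (x\<^sup>2 * (W + 1)\<^sup>2 / (4 * W ^ 3)) = x / W * (2 * (x / 2) + x / W)\<^sup>2" for x
      using Wpos by (simp add: divide_simps power2_eq_square power3_eq_cube)
        (simp add: algebra_simps)
    from this[of "\<bar>c\<bar>"] show ?thesis
      unfolding H2 sqrtK by simp
  qed
qed

theorem theorem1:
  fixes f g :: "real poly" and S :: "(real ^ 3) set"
  assumes "S = translation_surface (poly f) (poly g)"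
    and "weingarten (poly f) (poly g)"
  shows "(is_cylinder S \<and> (\<forall>u v. gauss_curvature (poly f) (poly g) u v = 0))
    \<or> (is_paraboloid_of_revolution S
       \<and> (\<exists>\<epsilon> \<in> {1, -1}. \<forall>u v. \<epsilon> * mean_curvature (poly f) (poly g) u v > 0)
       \<and> (\<forall>u v. gauss_curvature (poly f) (poly g) u v > 0)
       \<and> (\<exists>a > 0. \<forall>u v.
            8 * a * (mean_curvature (poly f) (poly g) u v)\<^sup>2
            = sqrt (gauss_curvature (poly f) (poly g) u v)
              * (2 * a + sqrt (gauss_curvature (poly f) (poly g) u v))\<^sup>2))"
proof (cases "pderiv (pderiv f) = 0 \<or> pderiv (pderiv g) = 0")
  case True
  then have "gauss_curvature (poly f) (poly g) u v = 0" for u v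
    by (auto simp: gauss_curvature_def deriv_poly)
  with is_cylinder_if_linear[OF True] show ?thesis
    unfolding assms(1) by blast
next
  case False
  then obtain c where c: "c \<noteq> 0" "pderiv (pderiv f) = [:c:]" "pderiv (pderiv g) = [:c:]"
    using weingarten_equal_second_derivatives[OF assms(2)] by blast
  have "sgn c \<in> {1, -1}"
    using c(1) by (auto simp: sgn_if)
  moreover have "\<bar>c\<bar> / 2 > 0"
    using c(1) by simp
  ultimately show ?thesis
    unfolding assms(1)
    using paraboloid_curvatures[OF c] is_paraboloid_of_revolution_if_equal_second_derivatives[OF c]
    by blast
qed

end
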